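(* For every $\omega\in\Omega$, the limit process $X=\{X_t,\ t\ge0\}$ has the following properties: (a) the set $\{t>0:\ X_t>0\}$ is open in the natural topology on $\mathbb{R}$; (b) $X$ is continuous on $\{t\ge 0:\ X_t>0\}$.
   Context: Fix $H\in(0,\tfrac12)$ and constants $X_0>0$, $a>0$, $b\ge 0$, $\sigma>0$. $B^H=\{B^H_t,\ t\ge 0\}$ is a fractional Brownian motion with Hurst parameter $H$ on a complete probability space $(\Omega,\mathcal{F},\mathbb{P})$, i.e. a mean zero Gaussian process with covariance $\mathbb{E}(B^H_tB^H_s)=\frac12(t^{2H}+s^{2H}-|t-s|^{2H})$. A version is fixed such that, for every $\omega\in\Omega$, $B^H_0(\omega)=0$ and the trajectory $t\mapsto B^H_t(\omega)$ is continuous and, on each interval $[0,T]$ and for each $\gamma\in(0,H)$, Hölder continuous of order $H-\gamma$; all pathwise statements are for an arbitrary fixed $\omega\in\Omega$. For $\varepsilon>0$, $X^\varepsilon=\{X^\varepsilon_t\}$ denotes the unique continuous process satisfying, for all $t\ge0$, $$X^\varepsilon_t=X_0+a\int_0^t\frac{(s+\varepsilon)^{2H-1}}{X^\varepsilon_s\mathbf{1}_{\{X^\varepsilon_s>0\}}+\varepsilon}\,ds-b\int_0^tX^\varepsilon_s\,ds+\sigma B^H_t.$$ For each $t\ge 0$, $X^\varepsilon_t$ is monotone in $\varepsilon$ (nondecreasing as $\varepsilon$ decreases) and bounded above uniformly in $\varepsilon$, and the process $X=\{X_t,\ t\ge0\}$ is defined by the finite pointwise limit $X_t=\lim_{\varepsilon\downarrow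 0}X^\varepsilon_t$. Continuity of $X$ on $\{t\ge0: X_t>0\}$ means that $t\mapsto X_t$, as a function on $[0,\infty)$, is continuous at each point of this set (right-continuous at $t=0$). *)

theory Defs
  imports "HOL-Probability.Probability"
begin

(* Real Gaussian law in the wide sense: point masses (variance 0) are included, as needed for
   degenerate linear combinations such as the value of a fractional Brownian motion at time 0. *)
definition gaussian_rv :: "'a measure \<Rightarrow> ('a \<Rightarrow> real) \<Rightarrow> bool" where
  "gaussian_rv M Y \<longleftrightarrow>
     Y \<in> borel_measurable M \<and>
     ((\<exists>\<mu>. AE \<omega> in M. Y \<omega> = \<mu>) \<or>
      (\<exists>\<mu> s. s > 0 \<and> distributed M lborel Y (normal_density \<mu> s)))"

(* Processes are functions of a real time of which only the values at times >= 0 matter.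
   Joint Gaussianity: every finite linear combination of the process values is Gaussian. *)
definition gaussian_process :: "'a measure \<Rightarrow> (real \<Rightarrow> 'a \<Rightarrow> real) \<Rightarrow> bool" where
  "gaussian_process M B \<longleftrightarrow>
     (\<forall>I c. finite I \<and> I \<subseteq> {0..} \<longrightarrow> gaussian_rv M (\<lambda>\<omega>. \<Sum>t\<in>I. c t * B t \<omega>))"

definition fractional_brownian_motion ::
    "'a measure \<Rightarrow> real \<Rightarrow> (real \<Rightarrow> 'a \<Rightarrow> real) \<Rightarrow> bool" where
  "fractional_brownian_motion M H B \<longleftrightarrow>
     gaussian_process M B \<and>
     (\<forall>t\<ge>0. integral\<^sup>L M (B t) = 0) \<and>
     (\<forall>t\<ge>0. \<forall>s\<ge>0. integral\<^sup>L M (\<lambda>\<omega>. B t \<omega> * B s \<omega>) =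
        1/2 * (t powr (2 * H) + s powr (2 * H) - \<bar>t - s\<bar> powr (2 * H)))"

definition hoelder_continuous_on :: "real \<Rightarrow> real set \<Rightarrow> (real \<Rightarrow> real) \<Rightarrow> bool" where
  "hoelder_continuous_on \<alpha> S f \<longleftrightarrow>
     (\<exists>C. \<forall>s\<in>S. \<forall>t\<in>S. \<bar>f t - f s\<bar> \<le> C * \<bar>t - s\<bar> powr \<alpha>)"

definition regular_path :: "real \<Rightarrow> (real \<Rightarrow> real) \<Rightarrow> bool" where
  "regular_path H w \<longleftrightarrow>
     w 0 = 0 \<and> continuous_on {0..} w \<and>
     (\<forall>T>0. \<forall>\<gamma>\<in>{0<..<H}. hoelder_continuous_on (H - \<gamma>) {0..T} w)"

(* x is a continuous solution, driven by the path w, of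
     x(t) = X0 + a int_0^t (s+eps)^(2H-1) / (x(s) 1_{x(s)>0} + eps) ds - b int_0^t x(s) ds + sigma w(t).
   For eps > 0 and continuous x both integrands are continuous on [0,t], so the integrals
   are ordinary Riemann integrals. *)
definition approx_solution ::
    "real \<Rightarrow> real \<Rightarrow> real \<Rightarrow> real \<Rightarrow> real \<Rightarrow> real \<Rightarrow> (real \<Rightarrow> real) \<Rightarrow> (real \<Rightarrow> real) \<Rightarrow> bool" where
  "approx_solution H X0 a b \<sigma> \<epsilon> w x \<longleftrightarrow>
     continuous_on {0..} x \<and>
     (\<forall>t\<ge>0. x t = X0
        + a * integral {0..t}
            (\<lambda>s. (s + \<epsilon>) powr (2 * H - 1) / (x s * indicator {0<..} (x s) + \<epsilon>))
        - b * integral {0..t} x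
        + \<sigma> * w t)"

end

theory Submission
  imports Defs
begin

text \<open>The drift coefficient decreases both in the state and in \<open>\<epsilon>\<close>, so comparing two solutions
  after the last time they agree shows that the approximations increase as \<open>\<epsilon>\<close> decreases.
  Where \<open>X\<close> is positive, some approximation is at least \<open>c > 0\<close> on a neighbourhood, and hence so are
  all later ones. There the singular drift is at most \<open>(s + \<epsilon>) powr (2 * H - 1) / c\<close>, whose
  primitive remains continuous as \<open>\<epsilon>\<close> tends to 0. This bounds the increments uniformly in \<open>\<epsilon>\<close>,
  and the bounds pass to the limit.\<close>

section \<open>The regularised singular drift\<close>

definition drift :: "real \<Rightarrow> real \<Rightarrow> (real \<Rightarrow> real) \<Rightarrow> real \<Rightarrow> real" where
  "drift H \<epsilon> x s = (s + \<epsilon>) powr (2 * H - 1) / (x s * indicator {0<..} (x s) + \<epsilon>)"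

text \<open>The cut-off state is its positive part, which makes both continuity and monotonicity in
  the state visible.\<close>

lemma drift_max: "drift H \<epsilon> x s = (s + \<epsilon>) powr (2 * H - 1) / (max 0 (x s) + \<epsilon>)"
  by (auto simp: drift_def indicator_def max_def)

lemma continuous_on_drift:
  assumes "\<epsilon> > 0" "continuous_on S x" "S \<subseteq> {0..}"
  shows "continuous_on S (drift H \<epsilon> x)"
proof -
  have "s + \<epsilon> > 0" if "s \<in> S" for s using that assms by force
  moreover have "max 0 (x s) + \<epsilon> > 0" for s using assms by linarith
  ultimately show ?thesis
    unfolding drift_max[abs_def]
    by (intro continuous_intros assms) (metis less_irrefl)+
qed

text \<open>The exponent \<open>2 * H - 1\<close> is negative, so the numerator decreases in
  \<epsilon>, while the denominator increases in \<epsilon> and in the state.\<close>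

lemma drift_mono:
  assumes "0 < \<epsilon>" "\<epsilon> \<le> \<epsilon>'" "x s \<le> y s" "0 \<le> s" "H < 1/2"
  shows "drift H \<epsilon>' y s \<le> drift H \<epsilon> x s"
  unfolding drift_max using assms
  by (intro frac_le powr_mono2') auto

section \<open>Increments of a solution and comparison of two solutions\<close>

lemma integral_diff_combine:
  fixes f :: "real \<Rightarrow> real"
  assumes "continuous_on {0..s} f" "0 \<le> r" "r \<le> s"
  shows "integral {0..s} f - integral {0..r} f = integral {r..s} f"
  using Henstock_Kurzweil_Integration.integral_combine
    [OF assms(2,3) integrable_continuous_real[OF assms(1)]] by simp

lemma approx_solution_increment:
  assumes sol: "approx_solution H X0 a b \<sigma> \<epsilon> w x" and "\<epsilon> > 0" "0 \<le> r" "r \<le> s"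
  shows "x s - x r = a * integral {r..s} (drift H \<epsilon> x) - b * integral {r..s} x + \<sigma> * (w s - w r)"
proof -
  have cont: "continuous_on {0..s} x"
    using sol unfolding approx_solution_def by (auto intro: continuous_on_subset)
  have eq: "x t = X0 + a * integral {0..t} (drift H \<epsilon> x) - b * integral {0..t} x + \<sigma> * w t"
    if "t \<ge> 0" for t
    using sol that unfolding approx_solution_def drift_def by blast
  have "x s - x r = a * (integral {0..s} (drift H \<epsilon> x) - integral {0..r} (drift H \<epsilon> x))
      - b * (integral {0..s} x - integral {0..r} x) + \<sigma> * (w s - w r)"
    using eq[of s] eq[of r] assms(3,4) by (simp add: algebra_simps)
  then show ?thesis
    using assms(2-4) cont continuous_on_drift[OF assms(2) cont]
    by (simp add: integral_diff_combine)
qed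

text \<open>The left endpoint is a null set. It is left out because the comparison below orders the
  solutions only strictly after their last crossing.\<close>

lemma integral_le_open:
  fixes f g :: "real \<Rightarrow> real"
  assumes "f integrable_on {u..t}" "g integrable_on {u..t}" "\<And>s. s \<in> {u<..t} \<Longrightarrow> f s \<le> g s"
  shows "integral {u..t} f \<le> integral {u..t} g"
proof -
  let ?f = "\<lambda>s. if s = u then g u else f s"
  have "integral {u..t} f = integral {u..t} ?f"
    by (rule integral_spike[of "{u}"]) auto
  also have "\<dots> \<le> integral {u..t} g"
  proof (rule integral_le)
    show "?f integrable_on {u..t}"
      by (rule integrable_spike[OF assms(1), of "{u}"]) auto
  qed (use assms in auto)
  finally show ?thesis .
qed

text \<open>Once \<open>x\<close> has fallen below \<open>y\<close>, both the singular drift and the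
  mean reversion push \<open>x - y\<close> upwards, and the noise cancels since both solutions are
  driven by the same path. So the difference cannot become negative.\<close>

lemma approx_solution_antimono:
  assumes sol: "approx_solution H X0 a b \<sigma> \<epsilon> w x" and sol': "approx_solution H X0 a b \<sigma> \<epsilon>' w y"
    and par: "0 < \<epsilon>" "\<epsilon> \<le> \<epsilon>'" "H < 1/2" "a > 0" "b \<ge> 0" and "t \<ge> 0"
  shows "y t \<le> x t"
proof (rule ccontr)
  assume neg: "\<not> y t \<le> x t"
  define d where "d s = x s - y s" for s
  have contx: "continuous_on {0..} x" and conty: "continuous_on {0..} y"
    using sol sol' unfolding approx_solution_def by auto
  have contd: "continuous_on {0..} d"
    unfolding d_def using contx conty by (intro continuous_intros)
  have d0: "d 0 = 0"
  proof -
    have "x 0 = X0 + \<sigma> * w 0" "y 0 = X0 + \<sigma> * w 0"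
      using sol sol' unfolding approx_solution_def by fastforce+
    then show ?thesis by (simp add: d_def)
  qed
  \<comment> \<open>With \<open>d s \<ge> 0\<close> instead of \<open>d s = 0\<close>, every time in
    \<open>{u<..t}\<close> lies outside \<open>Z\<close> and so has \<open>d < 0\<close>, without
    the intermediate value theorem. The common initial value puts 0 in \<open>Z\<close>.\<close>
  define Z where "Z = {0..t} \<inter> d -` {0..}"
  have "closed Z" unfolding Z_def
    by (intro continuous_closed_preimage continuous_on_subset[OF contd]) auto
  moreover have bdd: "bdd_above Z" unfolding Z_def by (auto intro!: bdd_above.I[of _ t])
  moreover have "0 \<in> Z" unfolding Z_def using \<open>t \<ge> 0\<close> d0 by auto
  ultimately have uZ: "Sup Z \<in> Z" by (intro closed_contains_Sup) auto
  define u where "u = Sup Z"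
  have u: "0 \<le> u" "u \<le> t" "d u \<ge> 0" using uZ unfolding u_def Z_def by auto
  have after: "x s \<le> y s" if "s \<in> {u<..t}" for s
  proof (rule ccontr)
    assume "\<not> x s \<le> y s"
    then have "s \<in> Z" using that u by (auto simp: Z_def d_def)
    then have "s \<le> u" unfolding u_def by (rule cSup_upper[OF _ bdd])
    then show False using that by simp
  qed
  have int: "f integrable_on {u..t}" if "continuous_on {0..} f" for f :: "real \<Rightarrow> real"
    using that u by (intro integrable_continuous_real) (auto intro: continuous_on_subset)
  have ints: "x integrable_on {u..t}" "y integrable_on {u..t}"
      "drift H \<epsilon> x integrable_on {u..t}" "drift H \<epsilon>' y integrable_on {u..t}"
    using par contx conty by (auto intro!: int continuous_on_drift)
  have "integral {u..t} (drift H \<epsilon>' y) \<le> integral {u..t} (drift H \<epsilon> x)"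
    using ints u par after drift_mono[OF par(1,2) _ _ par(3)]
    by (intro integral_le_open) auto
  moreover have "integral {u..t} x \<le> integral {u..t} y"
    using ints after by (intro integral_le_open) auto
  ultimately have "0 \<le> a * (integral {u..t} (drift H \<epsilon> x) - integral {u..t} (drift H \<epsilon>' y))
      + b * (integral {u..t} y - integral {u..t} x)"
    using par by simp
  also have "\<dots> = d t - d u"
    using approx_solution_increment[OF sol _ u(1,2)] approx_solution_increment[OF sol' _ u(1,2)] par
    by (simp add: d_def algebra_simps)
  finally show False using u neg by (simp add: d_def)
qed

section \<open>Bounds on increments in both directions\<close>

lemma has_integral_shift_powr:
  fixes \<epsilon> r s H :: real
  assumes "\<epsilon> > 0" "0 \<le> r" "r \<le> s" "H > 0"
  shows "((\<lambda>u. (u + \<epsilon>) powr (2 * H - 1)) has_integral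
           (s + \<epsilon>) powr (2 * H) / (2 * H) - (r + \<epsilon>) powr (2 * H) / (2 * H)) {r..s}"
proof (rule fundamental_theorem_of_calculus[OF \<open>r \<le> s\<close>])
  fix u assume "u \<in> {r..s}"
  \<comment> \<open>The base \<open>u + \<epsilon>\<close> is positive even at \<open>u = 0\<close>,
    so the power rule applies on the whole closed interval.\<close>
  then have "((\<lambda>u. (u + \<epsilon>) powr (2 * H) / (2 * H)) has_real_derivative (u + \<epsilon>) powr (2 * H - 1))
      (at u within {r..s})"
    using assms by (auto intro!: derivative_eq_intros)
  then show "((\<lambda>u. (u + \<epsilon>) powr (2 * H) / (2 * H)) has_vector_derivative (u + \<epsilon>) powr (2 * H - 1))
      (at u within {r..s})"
    by (simp add: has_real_derivative_iff_has_vector_derivative)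
qed

lemma approx_solution_increment_le:
  assumes sol: "approx_solution H X0 a b \<sigma> \<epsilon> w x"
    and par: "\<epsilon> > 0" "H > 0" "a > 0" "b \<ge> 0" "c > 0"
    and rs: "0 \<le> r" "r \<le> s" and low: "\<And>u. u \<in> {r..s} \<Longrightarrow> c \<le> x u"
  shows "x s - x r \<le> a / c * ((s + \<epsilon>) powr (2 * H) / (2 * H) - (r + \<epsilon>) powr (2 * H) / (2 * H))
           + \<sigma> * (w s - w r)"
proof -
  let ?G = "(s + \<epsilon>) powr (2 * H) / (2 * H) - (r + \<epsilon>) powr (2 * H) / (2 * H)"
  have cont: "continuous_on {r..s} x"
    using sol rs unfolding approx_solution_def by (auto intro: continuous_on_subset)
  have "drift H \<epsilon> x u \<le> (u + \<epsilon>) powr (2 * H - 1) / c" if "u \<in> {r..s}" for u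
    unfolding drift_max using low[OF that] par by (intro frac_le) auto
  moreover have "drift H \<epsilon> x integrable_on {r..s}"
    using par rs cont by (auto intro!: integrable_continuous_real continuous_on_drift)
  ultimately have "integral {r..s} (drift H \<epsilon> x) \<le> ?G / c"
    using has_integral_divide[OF has_integral_shift_powr[OF par(1) rs par(2)], of c]
    by (intro has_integral_le[OF integrable_integral]) auto
  then have "a * integral {r..s} (drift H \<epsilon> x) \<le> a * (?G / c)"
    using par by (intro mult_left_mono) auto
  moreover have "0 \<le> integral {r..s} x"
    using cont low par by (intro integral_nonneg integrable_continuous_real) force+
  then have "0 \<le> b * integral {r..s} x" using par by simp
  ultimately show ?thesis
    unfolding approx_solution_increment[OF sol par(1) rs] by simp
qed

text \<open>The drift is nonnegative, so apart from the noise a solution can only lose through mean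
  reversion, at rate at most \<open>b * K\<close>.\<close>

lemma approx_solution_increment_ge:
  assumes sol: "approx_solution H X0 a b \<sigma> \<epsilon> w x"
    and par: "\<epsilon> > 0" "a > 0" "b \<ge> 0"
    and rs: "0 \<le> r" "r \<le> s" and up: "\<And>u. u \<in> {r..s} \<Longrightarrow> x u \<le> K"
  shows "- (b * K * (s - r)) + \<sigma> * (w s - w r) \<le> x s - x r"
proof -
  have cont: "continuous_on {r..s} x"
    using sol rs unfolding approx_solution_def by (auto intro: continuous_on_subset)
  have "0 \<le> integral {r..s} (drift H \<epsilon> x)"
    using par rs cont
    by (intro integral_nonneg integrable_continuous_real continuous_on_drift)
      (auto simp: drift_max)
  then have "0 \<le> a * integral {r..s} (drift H \<epsilon> x)" using par by simp
  moreover have "integral {r..s} x \<le> integral {r..s} (\<lambda>_. K)"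
    using cont up by (intro integral_le integrable_continuous_real) auto
  then have "b * integral {r..s} x \<le> b * (K * (s - r))"
    using par rs by (intro mult_left_mono) (auto simp: mult.commute)
  ultimately show ?thesis
    unfolding approx_solution_increment[OF sol par(1) rs] by (simp add: mult.assoc)
qed

section \<open>Passage to the limit near a time where it is positive\<close>

lemma continuous_limit_of_approx_solutions:
  fixes x :: "real \<Rightarrow> real \<Rightarrow> real" and y w :: "real \<Rightarrow> real"
  assumes par: "0 < H" "H < 1/2" "a > 0" "b \<ge> 0"
    and contw: "continuous_on {0..} w"
    and sol: "\<And>\<epsilon>. \<epsilon> > 0 \<Longrightarrow> approx_solution H X0 a b \<sigma> \<epsilon> w (x \<epsilon>)"
    and lim: "\<And>t. t \<ge> 0 \<Longrightarrow> ((\<lambda>\<epsilon>. x \<epsilon> t) \<longlongrightarrow> y t) (at_right 0)"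
    and t: "t \<ge> 0" "y t > 0"
  shows "continuous (at t within {0..}) y"
proof -
  have near0: "eventually (\<lambda>\<epsilon>::real. 0 < \<epsilon> \<and> \<epsilon> < e) (at_right 0)" if "e > 0" for e
    using that eventually_at_right_field by blast
  have "eventually (\<lambda>\<epsilon>. x \<epsilon> t > 0 \<and> \<epsilon> > 0) (at_right 0)"
    using order_tendstoD(1)[OF lim[OF t(1)] t(2)] eventually_at_right_less
    by (rule eventually_conj)
  then obtain e where e: "e > 0" "x e t > 0"
    using eventually_happens trivial_limit_at_right_real by blast
  \<comment> \<open>Half of the value at \<open>t\<close> leaves a strict gap, so continuity of the
    single function \<open>x e\<close> keeps it above \<open>c\<close> near
    \<open>t\<close>.\<close>
  define c where "c = x e t / 2"
  have c: "c > 0" "c < x e t" using e by (auto simp: c_def)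
  have conte: "continuous_on {0..} (x e)" using sol[OF e(1)] by (simp add: approx_solution_def)
  have mono: "x \<epsilon>' s \<le> x \<epsilon> s" if "0 < \<epsilon>" "\<epsilon> \<le> \<epsilon>'" "s \<ge> 0" for \<epsilon> \<epsilon>' s
    using approx_solution_antimono[OF sol sol that(1,2) par(2-4) that(3)] that by simp
  have le_lim: "x \<epsilon> s \<le> y s" if "0 < \<epsilon>" "s \<ge> 0" for \<epsilon> s
    by (rule tendsto_lowerbound[OF lim[OF that(2)]])
      (use near0[OF that(1)] mono that in \<open>auto elim: eventually_mono\<close>)
  have ev: "eventually (\<lambda>s. c < x e s) (at t within {0..})"
    using conte t c by (intro order_tendstoD(1)) (auto simp: continuous_on_def)
  \<comment> \<open>The factor 2 leaves room for the closed interval of radius \<delta> around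
    \<open>t\<close>.\<close>
  then obtain \<delta> where \<delta>: "\<delta> > 0"
    and low_e: "\<And>s. s \<ge> 0 \<Longrightarrow> \<bar>s - t\<bar> < 2 * \<delta> \<Longrightarrow> c \<le> x e s"
  proof -
    obtain d where d: "d > 0" "\<And>s. s \<in> {0..} \<Longrightarrow> s \<noteq> t \<Longrightarrow> dist s t < d \<Longrightarrow> c < x e s"
      using ev by (auto simp: eventually_at)
    have "c \<le> x e s" if "s \<ge> 0" "\<bar>s - t\<bar> < 2 * (d/2)" for s
      using d(2)[of s] that c by (cases "s = t") (auto simp: dist_real_def)
    with d(1) that[of "d/2"] show thesis by auto
  qed
  \<comment> \<open>Cutting \<open>p\<close> off at 0 covers \<open>t = 0\<close>, where the
    neighbourhood is one-sided.\<close>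
  define p q where "p = max 0 (t - \<delta>)" and "q = t + \<delta>"
  have pq: "0 \<le> p" "p \<le> t" "t < q" using \<delta> t by (auto simp: p_def q_def)
  have low: "c \<le> x \<epsilon> s" if "0 < \<epsilon>" "\<epsilon> < e" "s \<in> {p..q}" for \<epsilon> s
  proof -
    have "s \<ge> 0" "\<bar>s - t\<bar> < 2 * \<delta>" using that \<delta> pq by (auto simp: p_def q_def)
    from low_e[OF this] mono[of \<epsilon> e s] that \<open>s \<ge> 0\<close> show ?thesis by simp
  qed
  \<comment> \<open>\<open>a / c\<close> times the primitive of the shifted power. Since
    \<open>2 * H > 0\<close>, \<open>G 0\<close> is continuous up to time 0, although the unshifted
    integrand blows up there.\<close>
  define G where "G \<epsilon> s = a / c * ((s + \<epsilon>) powr (2 * H) / (2 * H))" for \<epsilon> s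
  have limG: "((\<lambda>\<epsilon>. G \<epsilon> s) \<longlongrightarrow> G 0 s) (at_right 0)" if "s \<ge> 0" for s
  proof -
    have "((\<lambda>\<epsilon>. s + \<epsilon>) \<longlongrightarrow> s + 0) (at_right 0)"
      by (intro tendsto_intros)
    \<comment> \<open>At \<open>s = 0\<close> the base tends to 0, so the limit of the power needs
      an eventually nonnegative base and a positive exponent.\<close>
    moreover have "\<forall>\<^sub>F \<epsilon> in at_right 0. 0 \<le> s + \<epsilon>"
      using near0[of 1] that by (auto elim: eventually_mono)
    ultimately have "((\<lambda>\<epsilon>. (s + \<epsilon>) powr (2 * H)) \<longlongrightarrow> (s + 0) powr (2 * H)) (at_right 0)"
      using par by (intro tendsto_powr') auto
    then show ?thesis
      unfolding G_def using par by (intro tendsto_mult tendsto_divide tendsto_const) auto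
  qed
  \<comment> \<open>The upper estimate comes first because it supplies the bound \<open>K\<close>
    used in the lower one.\<close>
  have upper: "y s - y r \<le> G 0 s - G 0 r + \<sigma> * (w s - w r)" if "p \<le> r" "r \<le> s" "s \<le> q" for r s
  proof (rule tendsto_le)
    show "((\<lambda>\<epsilon>. x \<epsilon> s - x \<epsilon> r) \<longlongrightarrow> y s - y r) (at_right 0)"
      using that pq by (intro tendsto_diff lim) auto
    show "((\<lambda>\<epsilon>. G \<epsilon> s - G \<epsilon> r + \<sigma> * (w s - w r)) \<longlongrightarrow> G 0 s - G 0 r + \<sigma> * (w s - w r)) (at_right 0)"
      using that pq by (intro tendsto_intros limG) auto
    show "\<forall>\<^sub>F \<epsilon> in at_right 0. x \<epsilon> s - x \<epsilon> r \<le> G \<epsilon> s - G \<epsilon> r + \<sigma> * (w s - w r)"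
      using near0[OF e(1)]
    proof eventually_elim
      case (elim \<epsilon>)
      then show ?case
        using approx_solution_increment_le[OF sol, of \<epsilon> c r s] low that pq par c
        by (auto simp: G_def right_diff_distrib)
    qed
  qed simp
  have contG: "continuous_on {0..} (G 0)"
    unfolding G_def using par c by (auto intro!: continuous_intros continuous_on_powr')
  have cont_pq: "continuous_on {p..q} (G 0)" "continuous_on {p..q} w"
    using contG contw pq by (auto intro: continuous_on_subset)
  \<comment> \<open>Continuity of \<open>y\<close> is not yet available. The bound comes from
    \<open>upper\<close> started at \<open>p\<close>, whose right-hand side is continuous on a
    compact interval.\<close>
  obtain K where K: "\<And>s. s \<in> {p..q} \<Longrightarrow> y s \<le> K"
  proof -
    have "continuous_on {p..q} (\<lambda>s. y p + (G 0 s - G 0 p + \<sigma> * (w s - w p)))"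
      using cont_pq by (intro continuous_intros)
    then obtain m where m: "\<forall>s\<in>{p..q}. y p + (G 0 s - G 0 p + \<sigma> * (w s - w p))
        \<le> y p + (G 0 m - G 0 p + \<sigma> * (w m - w p))"
      using continuous_attains_sup[of "{p..q}"] pq by fastforce
    have "y s \<le> y p + (G 0 m - G 0 p + \<sigma> * (w m - w p))" if "s \<in> {p..q}" for s
      using upper[of p s] m[rule_format, OF that] that by simp
    then show thesis using that by blast
  qed
  have lower: "- (b * K * (s - r)) + \<sigma> * (w s - w r) \<le> y s - y r"
    if "p \<le> r" "r \<le> s" "s \<le> q" for r s
  proof (rule tendsto_lowerbound)
    show "((\<lambda>\<epsilon>. x \<epsilon> s - x \<epsilon> r) \<longlongrightarrow> y s - y r) (at_right 0)"
      using that pq by (intro tendsto_diff lim) auto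
    show "\<forall>\<^sub>F \<epsilon> in at_right 0. - (b * K * (s - r)) + \<sigma> * (w s - w r) \<le> x \<epsilon> s - x \<epsilon> r"
      using near0[OF e(1)]
    proof eventually_elim
      case (elim \<epsilon>)
      \<comment> \<open>Each approximation lies below the limit, so the bound on \<open>y\<close>
        serves all of them at once.\<close>
      have "x \<epsilon> u \<le> K" if "u \<in> {r..s}" for u
        using le_lim[of \<epsilon> u] K[of u] elim that \<open>p \<le> r\<close> \<open>s \<le> q\<close> pq by force
      then show ?case
        using approx_solution_increment_ge[OF sol, of \<epsilon> r s K] elim that pq par by auto
    qed
  qed simp
  \<comment> \<open>The absolute values dominate \<open>upper\<close> and \<open>lower\<close> at
    once, on either side of \<open>t\<close>.\<close>
  define V where "V s = \<bar>G 0 s - G 0 t\<bar> + \<bar>b * K * (s - t)\<bar> + \<bar>\<sigma> * (w s - w t)\<bar>" for s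
  have bound: "\<bar>y s - y t\<bar> \<le> V s" if "s \<in> {p..q}" for s
  proof (cases "s \<le> t")
    case True
    with upper[of s t] lower[of s t] that pq show ?thesis
      by (simp add: V_def algebra_simps abs_if split: if_splits)
  next
    case False
    with upper[of t s] lower[of t s] that pq show ?thesis
      by (simp add: V_def abs_if split: if_splits)
  qed
  have "(V \<longlongrightarrow> \<bar>G 0 t - G 0 t\<bar> + \<bar>b * K * (t - t)\<bar> + \<bar>\<sigma> * (w t - w t)\<bar>) (at t within {0..})"
    unfolding V_def using contG contw t by (intro tendsto_intros) (auto simp: continuous_on_def)
  then have V0: "(V \<longlongrightarrow> 0) (at t within {0..})" by simp
  have "eventually (\<lambda>s. s \<in> {p..q}) (at t within {0..})"
    unfolding eventually_at using \<delta>
    by (intro exI[of _ \<delta>]) (auto simp: p_def q_def dist_real_def)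
  then have "eventually (\<lambda>s. norm (y s - y t) \<le> V s) (at t within {0..})"
    by eventually_elim (use bound in simp)
  then have "((\<lambda>s. y s - y t) \<longlongrightarrow> 0) (at t within {0..})"
    using V0 by (rule Lim_null_comparison)
  then show ?thesis by (simp add: continuous_within LIM_zero_iff)
qed

theorem theorem3p7:
  fixes M :: "'a measure"
    and H X0 a b \<sigma> :: real
    and B :: "real \<Rightarrow> 'a \<Rightarrow> real"
    and Xe :: "real \<Rightarrow> real \<Rightarrow> 'a \<Rightarrow> real"
    and X :: "real \<Rightarrow> 'a \<Rightarrow> real"
  assumes "0 < H" and "H < 1/2"
    and "X0 > 0" and "a > 0" and "b \<ge> 0" and "\<sigma> > 0"
    and "prob_space M" and "complete_measure M"
    and "fractional_brownian_motion M H B"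
    and "\<And>\<omega>. \<omega> \<in> space M \<Longrightarrow> regular_path H (\<lambda>t. B t \<omega>)"
    and "\<And>\<epsilon> \<omega>. \<epsilon> > 0 \<Longrightarrow> \<omega> \<in> space M \<Longrightarrow>
           approx_solution H X0 a b \<sigma> \<epsilon> (\<lambda>t. B t \<omega>) (\<lambda>t. Xe \<epsilon> t \<omega>)"
    and "\<And>t \<omega>. t \<ge> 0 \<Longrightarrow> \<omega> \<in> space M \<Longrightarrow>
           ((\<lambda>\<epsilon>. Xe \<epsilon> t \<omega>) \<longlongrightarrow> X t \<omega>) (at_right 0)"
  shows "\<forall>\<omega>\<in>space M.
           open {t. t > 0 \<and> X t \<omega> > 0} \<and>
           (\<forall>t\<in>{t. t \<ge> 0 \<and> X t \<omega> > 0}. continuous (at t within {0..}) (\<lambda>s. X s \<omega>))"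
proof (intro ballI conjI)
  fix \<omega> assume \<omega>: "\<omega> \<in> space M"
  have contw: "continuous_on {0..} (\<lambda>t. B t \<omega>)"
    using assms(10)[OF \<omega>] by (simp add: regular_path_def)
  have cont: "continuous (at t within {0..}) (\<lambda>s. X s \<omega>)" if "t \<ge> 0" "X t \<omega> > 0" for t
    by (rule continuous_limit_of_approx_solutions
        [OF assms(1,2,4,5) contw assms(11)[OF _ \<omega>] assms(12)[OF _ \<omega>] that])
  then show "continuous (at t within {0..}) (\<lambda>s. X s \<omega>)" if "t \<in> {t. t \<ge> 0 \<and> X t \<omega> > 0}" for t
    using that by simp
  show "open {t. t > 0 \<and> X t \<omega> > 0}"
  proof (subst open_subopen, intro ballI)
    fix t assume "t \<in> {t. t > 0 \<and> X t \<omega> > 0}"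
    then have t: "t > 0" "X t \<omega> > 0" by auto
    then have "at t within {0..} = at t" by (intro at_within_interior) simp
    \<comment> \<open>Convergence along \<open>nhds t\<close>, which includes the point
      \<open>t\<close> itself, turns an eventual property into an open set containing
      \<open>t\<close>.\<close>
    with cont[of t] t have "((\<lambda>s. X s \<omega>) \<longlongrightarrow> X t \<omega>) (nhds t)"
      by (simp add: continuous_within tendsto_at_iff_tendsto_nhds[of "\<lambda>s. X s \<omega>"])
    from order_tendstoD(1)[OF this t(2)] eventually_nhds_in_open[of "{0<..}" t] t(1)
    have "eventually (\<lambda>s. s > 0 \<and> X s \<omega> > 0) (nhds t)"
      by (simp add: eventually_conj)
    then show "\<exists>T. open T \<and> t \<in> T \<and> T \<subseteq> {t. t > 0 \<and> X t \<omega> > 0}"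
      by (auto simp: eventually_nhds subset_eq)
  qed
qed

end
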